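(* Let $M>\frac23$. The equation $$(2-3M)\,\lambda^6+6\,\lambda^2+4+3M=0$$ has a unique solution $\lambda^*>0$. For $\lambda>0$, let ${\rm D}\widehat T(\lambda,\lambda,\lambda)$ be the Jacobian matrix, at the radial point $(\lambda,\lambda,\lambda)$, of the vector $\widehat T=(T_1,T_2,T_3)^T$ of principal Biot stresses of the Neo-Hooke-Ciarlet-Geymonat material. Then ${\rm D}\widehat T(\lambda,\lambda,\lambda)$ is positive definite if $0<\lambda<\lambda^*$; it is singular (so $\widehat T$ loses differentiable invertibility) if $\lambda=\lambda^*$; and it is not positive semi-definite if $\lambda>\lambda^*$.
   Context: For $M>\frac23$, the principal Biot stresses of the (one-parameter) Neo-Hooke-Ciarlet-Geymonat material are the functions of the principal stretches $(\lambda_1,\lambda_2,\lambda_3)\in(0,\infty)^3$ given by $$T_i(\lambda_1,\lambda_2,\lambda_3)=\lambda_i-\frac1{\lambda_i}+\Big(\frac M2-\frac13\Big)\Big(\frac{\lambda_1^2\lambda_2^2\lambda_3^2}{\lambda_i}-\frac1{\lambda_i}\Big),\qquad i=1,2,3.$$ They are the partial derivatives of the energy expressed in the principal stretches, so ${\rm D}\widehat T=(\partial T_i/\partial\lambda_j)_{i,j}$ is a symmetric $3\times 3$ matrix. *)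

theory Defs
  imports "HOL-Analysis.Analysis"
begin

text \<open>Principal Biot stresses of the Neo-Hooke-Ciarlet-Geymonat material. They are meant on the
  open positive octant only; values elsewhere are junk coming from \<open>1 / 0 = 0\<close>.\<close>

definition biot_stress :: "real \<Rightarrow> real^3 \<Rightarrow> real^3" where
  "biot_stress M x = (\<chi> i. x $ i - 1 / x $ i
     + (M / 2 - 1 / 3) * ((x $ 1)\<^sup>2 * (x $ 2)\<^sup>2 * (x $ 3)\<^sup>2 / x $ i - 1 / x $ i))"

text \<open>Symmetry is deliberately not part of the following two definitions, so that the negation of
  semi-definiteness always exhibits a negative value of the quadratic form.\<close>

definition pos_definite :: "real^'n^'n \<Rightarrow> bool" where
  "pos_definite A \<longleftrightarrow> (\<forall>v. v \<noteq> 0 \<longrightarrow> v \<bullet> (A *v v) > 0)"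

definition pos_semidefinite :: "real^'n^'n \<Rightarrow> bool" where
  "pos_semidefinite A \<longleftrightarrow> (\<forall>v. v \<bullet> (A *v v) \<ge> 0)"

text \<open>Since \<open>U\<close> may be shrunk around an interior point of the domain of \<open>f\<close>, no explicit domain
  is needed.\<close>

definition local_diffeo_at :: "(real^'n \<Rightarrow> real^'n) \<Rightarrow> real^'n \<Rightarrow> bool" where
  "local_diffeo_at f x \<longleftrightarrow> (\<exists>U V g. open U \<and> open V \<and> x \<in> U \<and> homeomorphism U V f g
     \<and> f differentiable_on U \<and> g differentiable_on V)"

end

theory Submission
  imports Defs
begin

text \<open>At a radial point the Jacobian has the form $d I + b J$ with $J$ the all-ones matrix and
  $b > 0$. Its eigenvalues are $d$ (twice) and $d + 3b$, and $6\lambda^2 d$ is exactly the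
  polynomial of the statement, which changes sign only once because its quotient by $\lambda^6$ is
  strictly decreasing. If the stress had a differentiable local inverse at a radial point with
  $d = 0$, the chain rule would make the Jacobian injective, although it annihilates $(1,-1,0)$.\<close>

definition diag_plus_const :: "real \<Rightarrow> real \<Rightarrow> real^'n^'n" where
  "diag_plus_const d b = (\<chi> i j. (if i = j then d else 0) + b)"

lemma diag_plus_const_mult_vec:
  "diag_plus_const d b *v v = d *\<^sub>R v + (\<chi> i. b * sum (($) v) UNIV)"
  by (simp add: diag_plus_const_def matrix_vector_mult_def vec_eq_iff distrib_right
      sum.distrib sum_distrib_left if_distrib[of "\<lambda>x. x * _"] cong: if_cong)

lemma inner_diag_plus_const:
  "v \<bullet> (diag_plus_const d b *v v) = d * (v \<bullet> v) + b * (sum (($) v) UNIV)\<^sup>2"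
  unfolding diag_plus_const_mult_vec inner_add_right
  by (simp add: inner_vec_def power2_eq_square sum_distrib_left sum_distrib_right mult_ac)

lemma transpose_diag_plus_const: "transpose (diag_plus_const d b) = diag_plus_const d b"
  by (simp add: transpose_def diag_plus_const_def vec_eq_iff)

text \<open>The all-ones part contributes \<open>b\<close> times the squared coordinate sum, which
  is never negative, so \<open>d * (v \<bullet> v)\<close> already secures strict
  positivity.\<close>

lemma pos_definite_diag_plus_const:
  assumes "d > 0" "b \<ge> 0"
  shows "pos_definite (diag_plus_const d b)"
  unfolding pos_definite_def inner_diag_plus_const
  using assms by (simp add: add_pos_nonneg)

text \<open>At the radial point the partial derivatives are
  \<open>1 + (1 + c) / l^2 + c * l^4\<close> on the diagonal and \<open>2 * c * l^4\<close> off it.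
  The first parameter of \<open>diag_plus_const\<close> is the difference of the two.\<close>

lemma biot_stress_has_derivative_radial:
  fixes M l :: real
  assumes "l > 0"
  defines "c \<equiv> M / 2 - 1 / 3"
  shows "(biot_stress M has_derivative
    (*v) (diag_plus_const (1 + (1 + c) / l\<^sup>2 - c * l ^ 4) (2 * c * l ^ 4))) (at (vec l))"
proof -
  have comp: "((\<lambda>x. biot_stress M x $ i) has_derivative
      (\<lambda>h. (diag_plus_const (1 + (1 + c) / l\<^sup>2 - c * l ^ 4) (2 * c * l ^ 4) *v h) $ i))
      (at (vec l))" for i :: 3
    unfolding biot_stress_def vec_lambda_beta c_def[symmetric]
    using exhaust_3[of i] \<open>l > 0\<close>
    by (auto intro!: derivative_eq_intros
        bounded_linear_imp_has_derivative[OF bounded_linear_vec_nth] ext simp: diag_plus_const_mult_vec sum_3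
        field_simps power2_eq_square power4_eq_xxxx)
  show ?thesis
    unfolding has_derivative_componentwise_within[of "biot_stress M"]
    using comp by (auto simp: Basis_vec_def inner_axis)
qed

lemma jacobian_eqI:
  fixes A :: "real^'n^'m"
  assumes "(f has_derivative (*v) A) (at x)"
  shows "jacobian f (at x) = A"
  unfolding jacobian_def frechet_derivative_at[OF assms, symmetric]
  by (rule matrix_of_matrix_vector_mul)

text \<open>The derivative of the local inverse at \<open>f x\<close> is a left inverse of
  \<open>f'\<close>. This is what turns a singular Jacobian into a failure of differentiable
  invertibility.\<close>

lemma local_diffeo_at_derivative_kernel:
  assumes "local_diffeo_at f x" "(f has_derivative f') (at x)" "f' v = 0"
  shows "v = 0"
proof -
  obtain U V g where "open U" "open V" "x \<in> U" and hom: "homeomorphism U V f g"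
    and g: "g differentiable_on V"
    using assms(1) unfolding local_diffeo_at_def by blast
  then have "f x \<in> V"
    by (auto simp: homeomorphism_def)
  then obtain g' where g': "(g has_derivative g') (at (f x))"
    using g \<open>open V\<close> unfolding differentiable_on_def differentiable_def
    by (metis at_within_open)
  have "(g \<circ> f has_derivative g' \<circ> f') (at x)"
    using diff_chain_at[OF assms(2) g'] .
  \<comment> \<open>The composition \<open>g \<circ> f\<close> equals \<open>id\<close> only on
    \<open>U\<close>, but \<open>U\<close> is an open neighbourhood of \<open>x\<close>, which is
    enough for the derivative.\<close>
  then have "(id has_derivative g' \<circ> f') (at x)"
    by (rule has_derivative_transform_within_open[OF _ \<open>open U\<close> \<open>x \<in> U\<close>])
      (use hom in \<open>auto simp: homeomorphism_def\<close>)
  then have "g' \<circ> f' = id"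
    using has_derivative_unique has_derivative_id by (metis id_def)
  then have "v = g' (f' v)"
    by (metis comp_apply id_apply)
  also have "\<dots> = 0"
    using linear_0[OF has_derivative_linear[OF g']] assms(3) by simp
  finally show ?thesis .
qed

text \<open>Intermediate value theorem: the polynomial is positive at 0, and its leading coefficient
  is negative, so it is nonpositive at some explicit point.\<close>

lemma radial_polynomial_has_root:
  fixes M :: real
  assumes "M > 2 / 3"
  shows "\<exists>s>0. (2 - 3 * M) * s ^ 6 + 6 * s ^ 2 + 4 + 3 * M = 0"
proof -
  define p where "p s = (2 - 3 * M) * s ^ 6 + 6 * s ^ 2 + 4 + 3 * M" for s
  define d where "d = 3 * M - 2"
  \<comment> \<open>In terms of \<open>d\<close> the polynomial is
    \<open>6 + d + 6 * s^2 - d * s^6\<close>. This \<open>x\<close> is at least 1 and makes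
    \<open>d * x^4 \<ge> d * x = 12 + d\<close>, so \<open>d * x^6\<close> dominates
    \<open>6 * x^2 + (6 + d) * x^2\<close>, hence also \<open>6 * x^2 + 6 + d\<close>.\<close>
  define x where "x = (12 + d) / d"
  have "d > 0"
    using assms by (simp add: d_def)
  then have x: "x \<ge> 1" and dx: "d * x = 12 + d"
    by (simp_all add: x_def)
  have "x \<le> x ^ 4"
    using x power_increasing[of 1 4 x] by simp
  then have "12 + d \<le> d * x ^ 4"
    using \<open>d > 0\<close> by (simp flip: dx)
  then have "x\<^sup>2 * (12 + d - d * x ^ 4) \<le> 0"
    by (simp add: mult_nonneg_nonpos)
  moreover have "(6 + d) * 1 \<le> (6 + d) * x\<^sup>2"
    using x \<open>d > 0\<close> by (intro mult_left_mono) auto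
  ultimately have "p x \<le> 0"
    unfolding p_def d_def by (simp add: algebra_simps flip: power_add)
  moreover have "p 0 > 0"
    using assms by (simp add: p_def)
  moreover have "continuous_on {0..x} p"
    unfolding p_def by (intro continuous_intros)
  ultimately obtain s where "0 \<le> s" "p s = 0"
    using IVT2'[of p x 0 0] x by auto
  with \<open>p 0 > 0\<close> have "s > 0"
    by (cases "s = 0") auto
  with \<open>p s = 0\<close> show ?thesis
    unfolding p_def by blast
qed

text \<open>Cross-multiplying the values at \<open>l\<close> and \<open>s\<close> by
  \<open>s^6\<close> and \<open>l^6\<close> and subtracting cancels the leading terms. What is left
  is a positive combination of \<open>s^4 - l^4\<close> and \<open>s^6 - l^6\<close>, both with the
  sign of \<open>s - l\<close>.\<close>

lemma radial_polynomial_sgn: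
  fixes M s l :: real
  assumes "M > 2 / 3" "s > 0" "l > 0" and root: "(2 - 3 * M) * s ^ 6 + 6 * s ^ 2 + 4 + 3 * M = 0"
  shows "sgn ((2 - 3 * M) * l ^ 6 + 6 * l ^ 2 + 4 + 3 * M) = sgn (s - l)"
proof -
  define p where "p = (2 - 3 * M) * l ^ 6 + 6 * l ^ 2 + 4 + 3 * M"
  have "p * s ^ 6 = p * s ^ 6 - ((2 - 3 * M) * s ^ 6 + 6 * s ^ 2 + 4 + 3 * M) * l ^ 6"
    by (simp add: root)
  also have "\<dots> = 6 * l\<^sup>2 * s\<^sup>2 * (s ^ 4 - l ^ 4) + (4 + 3 * M) * (s ^ 6 - l ^ 6)"
    unfolding p_def by algebra
  finally have p: "p * s ^ 6 = \<dots>" .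
  have pos: "6 * l\<^sup>2 * s\<^sup>2 > 0" "4 + 3 * M > 0"
    using assms by auto
  consider "l < s" | "l = s" | "l > s"
    by linarith
  then have "sgn (p * s ^ 6) = sgn (s - l)"
  proof cases
    case 1
    then have "s ^ 4 - l ^ 4 > 0" "s ^ 6 - l ^ 6 > 0"
      using \<open>l > 0\<close> by (simp_all add: power_strict_mono)
    with 1 show ?thesis
      unfolding p by (simp add: pos sgn_pos add_pos_pos)
  next
    case 2
    then show ?thesis
      unfolding p by simp
  next
    case 3
    then have "s ^ 4 - l ^ 4 < 0" "s ^ 6 - l ^ 6 < 0"
      using \<open>s > 0\<close> by (simp_all add: power_strict_mono)
    then have "p * s ^ 6 < 0"
      unfolding p using pos by (intro add_neg_neg mult_pos_neg)
    with 3 show ?thesis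
      by simp
  qed
  moreover have "sgn (s ^ 6) = 1"
    using \<open>s > 0\<close> by simp
  ultimately show ?thesis
    by (simp add: sgn_mult p_def)
qed

theorem mainTheorem5:
  fixes M :: real
  assumes "M > 2 / 3"
  shows "(\<exists>!s::real. s > 0 \<and> (2 - 3 * M) * s ^ 6 + 6 * s ^ 2 + 4 + 3 * M = 0) \<and>
    (\<forall>s::real. s > 0 \<and> (2 - 3 * M) * s ^ 6 + 6 * s ^ 2 + 4 + 3 * M = 0 \<longrightarrow>
      (\<forall>l::real. l > 0 \<longrightarrow>
        biot_stress M differentiable (at (vec l)) \<and>
        transpose (jacobian (biot_stress M) (at (vec l))) = jacobian (biot_stress M) (at (vec l)) \<and>
        (l < s \<longrightarrow> pos_definite (jacobian (biot_stress M) (at (vec l)))) \<and>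
        (l = s \<longrightarrow> \<not> invertible (jacobian (biot_stress M) (at (vec l))) \<and>
                    \<not> local_diffeo_at (biot_stress M) (vec l)) \<and>
        (l > s \<longrightarrow> \<not> pos_semidefinite (jacobian (biot_stress M) (at (vec l))))))"
proof (intro conjI allI impI; (elim conjE)?)
  show "\<exists>!s::real. s > 0 \<and> (2 - 3 * M) * s ^ 6 + 6 * s ^ 2 + 4 + 3 * M = 0"
  proof (rule ex_ex1I)
    show "\<exists>s. 0 < s \<and> (2 - 3 * M) * s ^ 6 + 6 * s ^ 2 + 4 + 3 * M = 0"
      using radial_polynomial_has_root[OF assms] by blast
  next
    fix s t :: real
    assume "0 < s \<and> (2 - 3 * M) * s ^ 6 + 6 * s ^ 2 + 4 + 3 * M = 0"
      and "0 < t \<and> (2 - 3 * M) * t ^ 6 + 6 * t ^ 2 + 4 + 3 * M = 0"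
    then show "s = t"
      \<comment> \<open>Evaluated at the second root \<open>t\<close>, the sign formula reads
        \<open>0 = sgn (s - t)\<close>.\<close>
      using radial_polynomial_sgn[OF assms, of s t] by (simp add: sgn_0_0)
  qed
next
  fix s l :: real
  assume "s > 0" and root: "(2 - 3 * M) * s ^ 6 + 6 * s ^ 2 + 4 + 3 * M = 0" and "l > 0"
  define c where "c = M / 2 - 1 / 3"
  define d where "d = 1 + (1 + c) / l\<^sup>2 - c * l ^ 4"
  define b where "b = 2 * c * l ^ 4"
  let ?A = "diag_plus_const d b :: real^3^3"
  \<comment> \<open>The factor \<open>6 * l^2\<close> clears all denominators, since
    \<open>6 * c = 3 * M - 2\<close> and \<open>6 * (1 + c) = 4 + 3 * M\<close>.\<close>
  have "6 * l\<^sup>2 * d = (2 - 3 * M) * l ^ 6 + 6 * l ^ 2 + 4 + 3 * M"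
    using \<open>l > 0\<close> by (simp add: d_def c_def field_simps flip: power_add)
  then have "sgn (6 * l\<^sup>2 * d) = sgn (s - l)"
    using radial_polynomial_sgn[OF assms \<open>s > 0\<close> \<open>l > 0\<close> root] by simp
  then have sgn_d: "sgn d = sgn (s - l)"
    using \<open>l > 0\<close> by (simp add: sgn_mult)
  have "b \<ge> 0"
    using assms by (simp add: b_def c_def)
  have deriv: "(biot_stress M has_derivative (*v) ?A) (at (vec l))"
    using biot_stress_has_derivative_radial[OF \<open>l > 0\<close>] by (simp add: d_def b_def c_def)
  then have J: "jacobian (biot_stress M) (at (vec l)) = ?A"
    by (rule jacobian_eqI)
  \<comment> \<open>The coordinates of \<open>v\<close> sum to 0, so the all-ones part annihilates
    it and \<open>v\<close> is an eigenvector for \<open>d\<close>. It witnesses a negative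
    quadratic form when \<open>d < 0\<close> and a nontrivial kernel when
    \<open>d = 0\<close>.\<close>
  define v :: "real^3" where "v = vector [1, -1, 0]"
  have "v \<noteq> 0" and sum_v: "sum (($) v) UNIV = 0"
    by (auto simp: v_def vec_eq_iff forall_3 sum_3)
  have Av: "?A *v v = d *\<^sub>R v"
    by (simp add: diag_plus_const_mult_vec sum_v vec_eq_iff)
  show "biot_stress M differentiable (at (vec l))"
    using deriv by (auto simp: differentiable_def)
  show "transpose (jacobian (biot_stress M) (at (vec l))) = jacobian (biot_stress M) (at (vec l))"
    by (simp add: J transpose_diag_plus_const)
  show "pos_definite (jacobian (biot_stress M) (at (vec l)))" if "l < s"
  proof -
    have "d > 0"
      using sgn_d that by (simp add: sgn_1_pos)
    with \<open>b \<ge> 0\<close> show ?thesis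
      unfolding J by (simp add: pos_definite_diag_plus_const)
  qed
  show "\<not> pos_semidefinite (jacobian (biot_stress M) (at (vec l)))" if "l > s"
  proof -
    have "d < 0"
      using sgn_d that by (simp add: sgn_1_neg)
    then have "v \<bullet> (?A *v v) < 0"
      using \<open>v \<noteq> 0\<close> by (simp add: Av mult_neg_pos)
    then show ?thesis
      unfolding J pos_semidefinite_def by (meson not_le)
  qed
  have kernel: "?A *v v = 0" if "l = s"
    using sgn_d that unfolding Av by (simp add: sgn_0_0)
  show "\<not> invertible (jacobian (biot_stress M) (at (vec l)))" if "l = s"
    using kernel[OF that] \<open>v \<noteq> 0\<close>
    by (auto simp: J invertible_left_inverse matrix_left_invertible_ker)
  show "\<not> local_diffeo_at (biot_stress M) (vec l)" if "l = s"
    using local_diffeo_at_derivative_kernel[OF _ deriv kernel[OF that]] \<open>v \<noteq> 0\<close> by blast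
qed

end
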